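(* Let $(H_2(n))_{n \in \mathbb{N}_0}$ be the two-dimensional Halton sequence in bases $2$ and $3$. There are constants $c_1 > 0$ and $c_2 > 0$ such that for infinitely many $N \in \mathbb{N}$ there exists a set $\Lambda_N \subseteq [0,1)^2$ with the following properties: (i) $\lambda_2(\Lambda_N) \geq c_1$, where $\lambda_2$ denotes two-dimensional Lebesgue measure; (ii) for every $\boldsymbol{x} \in \Lambda_N$ there exists $\boldsymbol{y} \in [0,1)^2$ with $\| \boldsymbol{x} - \boldsymbol{y} \| < \sqrt{8}\, N^{-1/14}$ (Euclidean norm) and \[ \big|\Delta(\boldsymbol{y}, (H_2(n))_{n=1}^N)\big| \geq c_2 (\log N)^2. \]
   Context: For an integer $b \geq 2$, the radical inverse function $\phi_b:\mathbb{N}_0 \to [0,1)$ is $\phi_b(n) = \sum_{j \geq 0} n_j b^{-j-1}$, where $n = \sum_{j\geq 0} n_j b^j$ with digits $n_j \in \{0,\dots,b-1\}$. The two-dimensional Halton sequence in bases $2,3$ is $H_2(n) = (\phi_2(n),\phi_3(n))$, $n = 0,1,2,\dots$. For $\boldsymbol{y} = (y^{(1)},y^{(2)}) \in [0,1]^2$, $\Delta(\boldsymbol{y},(H_2(n))_{n=1}^N) = \sum_{n=1}^N \big(\chi_{[0,y^{(1)})\times[0,y^{(2)})}(H_2(n)) - y^{(1)}y^{(2)}\big)$. $\log$ is the natural logarithm. *)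

theory Defs
  imports "HOL-Analysis.Analysis"
begin

text \<open>Radical inverse in base b: phi_b(n) = sum_j n_j b^(-j-1), computed by
  phi_b(n) = (n mod b + phi_b(n div b)) / b for n > 0, phi_b(0) = 0.\<close>
fun radical_inverse :: "nat \<Rightarrow> nat \<Rightarrow> real" where
  "radical_inverse b n =
     (if b < 2 \<or> n = 0 then 0
      else (real (n mod b) + radical_inverse b (n div b)) / real b)"

definition halton23 :: "nat \<Rightarrow> real \<times> real" where
  "halton23 n = (radical_inverse 2 n, radical_inverse 3 n)"

definition local_discrepancy :: "real \<times> real \<Rightarrow> nat \<Rightarrow> real" where
  "local_discrepancy y N =
     (\<Sum>n = 1..N. indicator ({0..<fst y} \<times> {0..<snd y}) (halton23 n) - fst y * snd y)"

end

theory Submission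
  imports Defs
begin

text \<open>
  Cut the unit square into the cells given by the first \<open>4k\<close> binary and ternary digits; by the
  Chinese remainder theorem a cell is a residue \<open>r\<close> modulo \<open>p = 6^(4k)\<close>. In each cell take the
  rectangle whose corners are the radical inverses of the truncations to \<open>12k\<close> and \<open>16k\<close>
  digits of the 2-adic and 3-adic expansions of the same rational number \<open>r - p / 5\<close>. The indices
  \<open>n\<close> falling into the rectangle form \<open>8k^2\<close> residue classes \<open>R\<close> modulo \<open>M = 2^i 3^j\<close>,
  and because the two expansions come from one rational with denominator 5, the ratio \<open>R / M\<close>
  is nearly a multiple of \<open>1/30\<close> depending only on \<open>i\<close> and \<open>j\<close> modulo 4. Averaged over
  \<open>N \<le> 6^(16k)\<close>, a class contributes about \<open>1/2 - R / M\<close> to the discrepancy of the rectangle,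
  and these contributions add up to a positive multiple of \<open>k^2\<close>. As every class contributes at
  most 1 for each \<open>N\<close>, double counting over pairs \<open>(r, N)\<close> gives one \<open>N\<close> for which a positive
  proportion of the cells have a rectangle of discrepancy at least \<open>k^2 / 5\<close>, and then one of
  its four corners has local discrepancy at least \<open>k^2 / 20\<close>.
\<close>

section \<open>Radical inverses\<close>

declare radical_inverse.simps [simp del]

lemma radical_inverse_0 [simp]: "radical_inverse b 0 = 0"
  by (simp add: radical_inverse.simps)

lemma radical_inverse_rec:
  "b \<ge> 2 \<Longrightarrow> radical_inverse b n = (real (n mod b) + radical_inverse b (n div b)) / real b"
  by (cases "n = 0") (simp_all add: radical_inverse.simps [of b n])

lemma radical_inverse_nonneg: "0 \<le> radical_inverse b n"
proof (induction b n rule: radical_inverse.induct)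
  case (1 b n)
  then show ?case
    by (subst radical_inverse.simps) auto
qed

lemma radical_inverse_le:
  assumes "b \<ge> 2" "n < b ^ i"
  shows "radical_inverse b n + 1 / real b ^ i \<le> 1"
  using assms(2)
proof (induction i arbitrary: n)
  case (Suc i)
  have "n div b < b ^ i"
    using Suc.prems by (simp add: less_mult_imp_div_less mult.commute)
  from Suc.IH [OF this] have IH: "radical_inverse b (n div b) + 1 / real b ^ i \<le> 1" .
  have "real (n mod b) + 1 \<le> real b"
    using assms(1) mod_less_divisor [of b n] by linarith
  with IH have "real (n mod b) + (radical_inverse b (n div b) + 1 / real b ^ i) \<le> real b"
    by linarith
  moreover have "radical_inverse b n + 1 / real b ^ Suc i
      = (real (n mod b) + (radical_inverse b (n div b) + 1 / real b ^ i)) / real b"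
    by (simp add: radical_inverse_rec [OF assms(1), of n] add_divide_distrib mult.commute)
  ultimately show ?case
    using assms(1) by simp
qed simp

lemma radical_inverse_less_1:
  assumes "b \<ge> 2"
  shows "radical_inverse b n < 1"
proof -
  have "n < b ^ n"
    using assms by (simp add: less_exp power_gt_expt)
  from radical_inverse_le [OF assms this]
  have "radical_inverse b n + 1 / real b ^ n \<le> 1" .
  moreover have "1 / real b ^ n > 0"
    using assms by simp
  ultimately show ?thesis
    by linarith
qed

text \<open>The lowest \<open>i\<close> digits of \<open>n\<close> are the leading \<open>i\<close>
  digits of its radical inverse. This is the bridge from intervals to congruences.\<close>

lemma radical_inverse_in_cell_iff:
  assumes "b \<ge> 2" "a < b ^ i"
  shows "radical_inverse b n \<in> {radical_inverse b a..<radical_inverse b a + 1 / real b ^ i}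
           \<longleftrightarrow> n mod b ^ i = a"
  using assms(2)
proof (induction i arbitrary: a n)
  case 0
  then show ?case
    using radical_inverse_less_1 [OF assms(1)] by (simp add: radical_inverse_nonneg)
next
  case (Suc i)
  have lt: "a div b < b ^ i"
    using Suc.prems by (simp add: less_mult_imp_div_less mult.commute)
  have le: "radical_inverse b (a div b) + 1 / real b ^ i \<le> 1"
    by (rule radical_inverse_le [OF assms(1) lt])
  have b: "real b > 0"
    using assms(1) by simp
  define x y f g h where "x = n mod b" and "y = a mod b" and "f = radical_inverse b (n div b)"
    and "g = radical_inverse b (a div b)" and "h = 1 / real b ^ i"
  have fg: "0 \<le> f" "f < 1" "0 \<le> g" "g + h \<le> 1"
    using le radical_inverse_nonneg radical_inverse_less_1 [OF assms(1)]
    by (auto simp: f_def g_def h_def)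
  have "radical_inverse b n \<in> {radical_inverse b a..<radical_inverse b a + 1 / real b ^ Suc i}
     \<longleftrightarrow> (real y + g) / real b \<le> (real x + f) / real b \<and>
         (real x + f) / real b < (real y + g + h) / real b"
    using radical_inverse_rec [OF assms(1), of n] radical_inverse_rec [OF assms(1), of a]
    by (simp add: x_def y_def f_def g_def h_def add_divide_distrib mult.commute)
  also have "\<dots> \<longleftrightarrow> real y + g \<le> real x + f \<and> real x + f < real y + g + h"
    using b by (simp add: divide_le_cancel divide_less_cancel)
  \<comment> \<open>Both \<open>f\<close> and the interval from \<open>g\<close> to
    \<open>g + h\<close> lie within the unit interval, so the integer parts \<open>x\<close> and
    \<open>y\<close> must agree.\<close>
  also have "\<dots> \<longleftrightarrow> x = y \<and> g \<le> f \<and> f < g + h"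
  proof -
    have "x = y" if "real y + g \<le> real x + f" "real x + f < real y + g + h"
    proof -
      have "real y < real x + 1" "real x < real y + 1"
        using that fg by linarith+
      then show ?thesis by linarith
    qed
    then show ?thesis by auto
  qed
  also have "\<dots> \<longleftrightarrow> n mod b = a mod b \<and> (n div b) mod b ^ i = a div b"
    using Suc.IH [OF lt, of "n div b"] by (auto simp: x_def y_def f_def g_def h_def)
  also have "\<dots> \<longleftrightarrow> n mod b ^ Suc i = a"
  proof -
    have "n mod b ^ Suc i = b * (n div b mod b ^ i) + n mod b"
      by (simp add: mod_mult2_eq)
    moreover have "n mod b ^ Suc i = a \<Longrightarrow> n mod b = a mod b"
      by (metis mod_mod_cancel dvd_triv_left power_Suc)
    moreover have "n mod b ^ Suc i = a \<Longrightarrow> n div b mod b ^ i = a div b"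
      using assms(1) \<open>n mod b ^ Suc i = b * (n div b mod b ^ i) + n mod b\<close>
      by (metis add.commute div_mult_self2 div_less mod_less_divisor add_0 not_numeral_le_zero gr0I)
    moreover have "b * (a div b) + a mod b = a"
      by simp
    ultimately show ?thesis
      by metis
  qed
  finally show ?case .
qed

text \<open>A new leading digit of the integer becomes the last digit of the radical inverse, at
  place \<open>i + 1\<close> behind the point.\<close>

lemma radical_inverse_append_digit:
  assumes "b \<ge> 2" "a < b ^ i" "d < b"
  shows "radical_inverse b (a + d * b ^ i) = radical_inverse b a + real d / real b ^ Suc i"
  using assms(2)
proof (induction i arbitrary: a)
  case 0
  then show ?case
    using assms radical_inverse_rec [OF assms(1), of d] by simp
next
  case (Suc i)
  have lt: "a div b < b ^ i"
    using Suc.prems by (simp add: less_mult_imp_div_less mult.commute)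
  have e: "a + d * b ^ Suc i = a + (d * b ^ i) * b"
    by simp
  have "(a + d * b ^ Suc i) mod b = a mod b" "(a + d * b ^ Suc i) div b = a div b + d * b ^ i"
    using assms(1) by (simp_all only: e mod_mult_self1 div_mult_self1)
  then have "radical_inverse b (a + d * b ^ Suc i)
      = (real (a mod b) + (radical_inverse b (a div b) + real d / real b ^ Suc i)) / real b"
    using Suc.IH [OF lt] radical_inverse_rec [OF assms(1), of "a + d * b ^ Suc i"]
    by (simp only:)
  also have "\<dots> = (real (a mod b) + radical_inverse b (a div b)) / real b
      + real d / real b ^ Suc (Suc i)"
    by (simp add: add_divide_distrib mult_ac)
  finally show ?case
    by (simp only: radical_inverse_rec [OF assms(1), of a, symmetric])
qed

lemma indicator_atLeastLessThan_split:
  fixes a b c :: real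
  assumes "a \<le> b" "b \<le> c"
  shows "indicator {a..<c} x = (indicator {a..<b} x + indicator {b..<c} x :: real)"
  using assms by (auto simp: indicator_def)

text \<open>The interval splits into \<open>z\<close> elementary intervals of level
  \<open>i + 1\<close>, one for each digit \<open>d < z\<close> at position
  \<open>i\<close>.\<close>

lemma indicator_radical_inverse_digits:
  assumes "b \<ge> 2" "a < b ^ i" "z \<le> b"
  shows "indicator {radical_inverse b a..<radical_inverse b a + real z / real b ^ Suc i}
           (radical_inverse b n) = (\<Sum>d<z. of_bool (n mod b ^ Suc i = a + d * b ^ i) :: real)"
  using assms(3)
proof (induction z)
  case (Suc z)
  let ?g = "radical_inverse b a" and ?h = "1 / real b ^ Suc i"
  have lt: "a + z * b ^ i < b ^ Suc i"
  proof -
    have "a + z * b ^ i < Suc z * b ^ i"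
      using assms(2) by simp
    also have "\<dots> \<le> b * b ^ i"
      using Suc.prems by (intro mult_right_mono) auto
    finally show ?thesis by simp
  qed
  have h: "?h > 0"
    using assms(1) by simp
  have cell: "indicator {?g + real z / real b ^ Suc i..<?g + real z / real b ^ Suc i + ?h}
        (radical_inverse b n) = (of_bool (n mod b ^ Suc i = a + z * b ^ i) :: real)"
    using radical_inverse_in_cell_iff [OF assms(1) lt, of n]
      radical_inverse_append_digit [OF assms(1,2), of z] Suc.prems
    by (simp add: indicator_def)
  have eq: "?g + real (Suc z) / real b ^ Suc i = ?g + real z / real b ^ Suc i + ?h"
    by (simp add: add_divide_distrib)
  have "indicator {?g..<?g + real (Suc z) / real b ^ Suc i} (radical_inverse b n)
      = (indicator {?g..<?g + real z / real b ^ Suc i} (radical_inverse b n)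
        + of_bool (n mod b ^ Suc i = a + z * b ^ i) :: real)"
    unfolding eq cell [symmetric]
    by (rule indicator_atLeastLessThan_split) (use h in auto)
  also have "\<dots> = (\<Sum>d<Suc z. of_bool (n mod b ^ Suc i = a + d * b ^ i))"
    using Suc.IH Suc.prems by simp
  finally show ?case .
qed simp

lemma mod_add_right_cancel_nat:
  "(m + k) mod n = (l + k) mod n \<longleftrightarrow> m mod n = l mod n" for k l m n :: nat
proof -
  have "(m + k) mod n = (l + k) mod n \<longleftrightarrow>
      (int m + int k) mod int n = (int l + int k) mod int n"
    by (metis of_nat_add of_nat_eq_iff zmod_int)
  also have "\<dots> \<longleftrightarrow> int m mod int n = int l mod int n"
    by (simp add: mod_eq_dvd_iff)
  finally show ?thesis
    by (metis of_nat_eq_iff zmod_int)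
qed

text \<open>The hypothesis makes \<open>z\<close> the digit of \<open>Z\<close> at position
  \<open>i\<close>; since the left side is below \<open>b ^ Suc i\<close>, the bound
  \<open>z < b\<close> follows.\<close>

lemma radical_inverse_mod_Suc:
  assumes "b \<ge> 2" and z: "Z mod b ^ Suc i = Z mod b ^ i + z * b ^ i"
  shows "radical_inverse b (Z mod b ^ Suc i)
           = radical_inverse b (Z mod b ^ i) + real z / real b ^ Suc i"
    and "z < b"
proof -
  have "Z mod b ^ Suc i < b * b ^ i"
    using assms(1) by simp
  then have "z * b ^ i < b * b ^ i"
    using z by linarith
  then show "z < b" by simp
  then show "radical_inverse b (Z mod b ^ Suc i)
           = radical_inverse b (Z mod b ^ i) + real z / real b ^ Suc i"
    unfolding z using assms by (intro radical_inverse_append_digit) auto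
qed

text \<open>The indices in question agree with \<open>Z\<close> below position \<open>i\<close> and
  have a smaller digit there. Sorting them by the deficit \<open>\<delta> = z - d\<close> instead of
  the digit \<open>d\<close> gives congruences whose right side is always \<open>Z\<close>, so that
  arithmetic of \<open>Z\<close> applies.\<close>

lemma indicator_radical_inverse_step:
  assumes "b \<ge> 2" and z: "Z mod b ^ Suc i = Z mod b ^ i + z * b ^ i"
  shows "indicator {radical_inverse b (Z mod b ^ i)..<radical_inverse b (Z mod b ^ Suc i)}
           (radical_inverse b n)
         = (\<Sum>\<delta>=1..z. of_bool ((n + \<delta> * b ^ i) mod b ^ Suc i = Z mod b ^ Suc i) :: real)"
proof -
  let ?a = "Z mod b ^ i" and ?B = "b ^ Suc i"
  have zb: "z < b"
    and g: "radical_inverse b (Z mod ?B) = radical_inverse b ?a + real z / real b ^ Suc i"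
    using radical_inverse_mod_Suc [OF assms] by blast+
  have a: "?a < b ^ i"
    using assms(1) by simp
  have "indicator {radical_inverse b ?a..<radical_inverse b (Z mod ?B)} (radical_inverse b n)
      = (\<Sum>d<z. of_bool (n mod ?B = ?a + d * b ^ i) :: real)"
    unfolding g using assms(1) a zb by (intro indicator_radical_inverse_digits) auto
  also have "\<dots> = (\<Sum>\<delta>=1..z. of_bool ((n + \<delta> * b ^ i) mod ?B = Z mod ?B))"
  proof (rule sum.reindex_bij_witness [of _ "\<lambda>\<delta>. z - \<delta>" "\<lambda>d. z - d"])
    fix d assume d: "d \<in> {..<z}"
    have Z: "Z mod ?B = (?a + d * b ^ i) + (z - d) * b ^ i"
    proof -
      have "d * b ^ i + (z - d) * b ^ i = z * b ^ i"
        using d by (simp flip: add_mult_distrib)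
      then show ?thesis
        using z by linarith
    qed
    have lt: "?a + d * b ^ i < ?B"
    proof -
      have "Z mod ?B < ?B"
        using assms(1) by simp
      then show ?thesis
        using Z by linarith
    qed
    have "(n + (z - d) * b ^ i) mod ?B = Z mod ?B \<longleftrightarrow>
        (n + (z - d) * b ^ i) mod ?B = ((?a + d * b ^ i) + (z - d) * b ^ i) mod ?B"
      using Z by (metis mod_mod_trivial)
    also have "\<dots> \<longleftrightarrow> n mod ?B = ?a + d * b ^ i"
      using lt by (simp only: mod_add_right_cancel_nat mod_less)
    finally show "of_bool ((n + (z - d) * b ^ i) mod ?B = Z mod ?B)
        = (of_bool (n mod ?B = ?a + d * b ^ i) :: real)"
      by simp
  qed auto
  finally show ?thesis .
qed

section \<open>Telescoping over a block of digit positions\<close>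

lemma indicator_telescope:
  fixes g :: "nat \<Rightarrow> real"
  assumes "\<And>i. i < m \<Longrightarrow> g (s + i) \<le> g (s + Suc i)"
  shows "g s \<le> g (s + m) \<and> indicator {g s..<g (s + m)} x
           = (\<Sum>i<m. indicator {g (s + i)..<g (s + Suc i)} x :: real)"
  using assms
proof (induction m)
  case (Suc m)
  have "g s \<le> g (s + m)" "g (s + m) \<le> g (s + Suc m)"
    using Suc by auto
  then show ?case
    using Suc indicator_atLeastLessThan_split [of "g s" "g (s + m)" "g (s + Suc m)" x]
    by (auto intro: order_trans)
qed simp

text \<open>The triple \<open>(l, u, \<delta>)\<close> encodes the digit position \<open>4 * l + u\<close> (counted from some start)
  together with an amount \<open>\<delta>\<close> by which that digit is lowered; \<open>\<zeta>\<close> is a digit pattern of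
  period 4.\<close>

definition digit_index :: "nat \<Rightarrow> (nat \<Rightarrow> nat) \<Rightarrow> (nat \<times> nat \<times> nat) set" where
  "digit_index k \<zeta> = {..<k} \<times> (SIGMA u:{..<4}. {1..\<zeta> u})"

lemma sum_digit_index:
  "(\<Sum>(l, u, \<delta>)\<in>digit_index k \<zeta>. F (4 * l + u) \<delta>)
     = (\<Sum>i<4 * k. \<Sum>\<delta>=1..\<zeta> (i mod 4). F i \<delta> :: real)"
proof -
  have "(\<Sum>(l, u, \<delta>)\<in>digit_index k \<zeta>. F (4 * l + u) \<delta>)
      = (\<Sum>l<k. \<Sum>u<4. \<Sum>\<delta>=1..\<zeta> u. F (4 * l + u) \<delta>)"
    unfolding digit_index_def
    by (subst sum.Sigma [symmetric], simp, simp, rule sum.cong, simp, subst sum.Sigma [symmetric])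
      auto
  also have "\<dots> = (\<Sum>i<4 * k. \<Sum>\<delta>=1..\<zeta> (i mod 4). F i \<delta>)"
  proof (induction k)
    case (Suc k)
    have "(\<Sum>i<4 * Suc k. G i) = (\<Sum>i<4 * k. G i) + (\<Sum>u<4. G (4 * k + u))"
      for G :: "nat \<Rightarrow> real"
      by (simp add: eval_nat_numeral)
    then show ?case
      using Suc by simp
  qed simp
  finally show ?thesis .
qed

text \<open>The interval between two truncations of \<open>Z\<close> is cut at all intermediate
  truncations, and each piece is sorted by digit deficit. Indicator and length become sums over the
  same index set, so that they can later be compared class by class.\<close>

lemma radical_inverse_periodic_digits:
  fixes Z S k :: nat
  assumes b: "b \<ge> 2"
    and z: "\<And>i. i < 4 * k \<Longrightarrow>
      Z mod b ^ Suc (S + i) = Z mod b ^ (S + i) + \<zeta> (i mod 4) * b ^ (S + i)"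
  defines "g \<equiv> \<lambda>i. radical_inverse b (Z mod b ^ i)"
  shows "indicator {g S..<g (S + 4 * k)} (radical_inverse b n)
       = (\<Sum>(l, u, \<delta>)\<in>digit_index k \<zeta>.
           of_bool ((n + \<delta> * b ^ (S + (4 * l + u))) mod b ^ Suc (S + (4 * l + u))
             = Z mod b ^ Suc (S + (4 * l + u))) :: real)"
    and "g (S + 4 * k) - g S
       = (\<Sum>(l, u, \<delta>)\<in>digit_index k \<zeta>. 1 / real b ^ Suc (S + (4 * l + u)))"
    and "g S \<le> g (S + 4 * k)"
proof -
  have step: "g (S + Suc i) = g (S + i) + real (\<zeta> (i mod 4)) / real b ^ Suc (S + i)"
    if "i < 4 * k" for i
    using radical_inverse_mod_Suc(1) [OF b z [OF that]] by (simp add: g_def)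
  then have mono: "g (S + i) \<le> g (S + Suc i)" if "i < 4 * k" for i
    using that by simp
  note tele = indicator_telescope [where g = g and s = S and m = "4 * k", OF mono, simplified]
  show "g S \<le> g (S + 4 * k)"
    using tele by blast
  have "indicator {g S..<g (S + 4 * k)} (radical_inverse b n)
      = (\<Sum>i<4 * k. indicator {g (S + i)..<g (S + Suc i)} (radical_inverse b n) :: real)"
    using tele by simp
  also have "\<dots> = (\<Sum>i<4 * k. \<Sum>\<delta>=1..\<zeta> (i mod 4).
      of_bool ((n + \<delta> * b ^ (S + i)) mod b ^ Suc (S + i) = Z mod b ^ Suc (S + i)))"
    using indicator_radical_inverse_step [OF b z] by (intro sum.cong refl) (simp add: g_def)
  finally show "indicator {g S..<g (S + 4 * k)} (radical_inverse b n)
       = (\<Sum>(l, u, \<delta>)\<in>digit_index k \<zeta>.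
           of_bool ((n + \<delta> * b ^ (S + (4 * l + u))) mod b ^ Suc (S + (4 * l + u))
             = Z mod b ^ Suc (S + (4 * l + u))) :: real)"
    by (simp only: sum_digit_index [where F = "\<lambda>i \<delta>. of_bool ((n + \<delta> * b ^ (S + i)) mod b ^ Suc (S + i)
             = Z mod b ^ Suc (S + i))"])
  have "g (S + 4 * k) - g S = (\<Sum>i<4 * k. g (S + Suc i) - g (S + i))"
    using sum_lessThan_telescope [of "\<lambda>i. g (S + i)" "4 * k"] by simp
  also have "\<dots> = (\<Sum>i<4 * k. \<Sum>\<delta>=1..\<zeta> (i mod 4). 1 / real b ^ Suc (S + i))"
    using step by (intro sum.cong refl) simp
  finally show "g (S + 4 * k) - g S
       = (\<Sum>(l, u, \<delta>)\<in>digit_index k \<zeta>. 1 / real b ^ Suc (S + (4 * l + u)))"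
    by (simp only: sum_digit_index [where F = "\<lambda>i \<delta>. 1 / real b ^ Suc (S + i)"])
qed

section \<open>Residue classes\<close>

lemma mod_mult_eq_iff_coprime_nat:
  fixes n R A B :: nat
  assumes "coprime A B"
  shows "n mod (A * B) = R mod (A * B) \<longleftrightarrow> n mod A = R mod A \<and> n mod B = R mod B"
proof -
  have *: "n mod M = R mod M \<longleftrightarrow> int M dvd int n - int R" for M :: nat
    by (metis mod_eq_dvd_iff of_nat_eq_iff zmod_int)
  have "coprime (int A) (int B)"
    using assms by simp
  then have "int A dvd x \<and> int B dvd x \<longleftrightarrow> int (A * B) dvd x" for x
    by (auto intro: divides_mult dvd_mult_left dvd_mult_right)
  then show ?thesis
    by (simp add: *)
qed

text \<open>With a representative in \<open>1..M\<close> the first index counted is \<open>R\<close>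
  itself. The right side is \<open>(N - R) div M + 1\<close>, written so that \<open>N < R\<close>
  correctly gives 0.\<close>

lemma count_residue_class:
  assumes "1 \<le> R" "R \<le> M"
  shows "(\<Sum>n=1..N. of_bool (n mod M = R mod M)) = real ((N + M - R) div M)"
proof (induction N)
  case 0
  then show ?case using assms by simp
next
  case (Suc N)
  have "Suc (N + M - R) mod M = 0 \<longleftrightarrow> (Suc (N + M - R) + R) mod M = (0 + R) mod M"
    by (simp only: mod_add_right_cancel_nat) simp
  also have "Suc (N + M - R) + R = Suc N + M"
    using assms by simp
  finally have "Suc (N + M - R) mod M = 0 \<longleftrightarrow> Suc N mod M = R mod M"
    by (simp only: mod_add_self2 add_0)
  moreover have "Suc N + M - R = Suc (N + M - R)"
    using assms by simp
  ultimately show ?case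
    using Suc by (simp add: div_Suc)
qed

definition class_deviation :: "nat \<Rightarrow> nat \<Rightarrow> nat \<Rightarrow> real" where
  "class_deviation M R N = (\<Sum>n=1..N. of_bool (n mod M = R mod M) - 1 / real M)"

lemma class_deviation_eq:
  assumes "1 \<le> R" "R \<le> M"
  shows "class_deviation M R N = real ((N + M - R) div M) - real N / real M"
  by (simp only: class_deviation_def sum_subtractf count_residue_class [OF assms]) simp

text \<open>The count is the floor of \<open>N / M\<close> plus a shift \<open>(M - R) / M\<close>
  from \<open>[0, 1)\<close>.\<close>

lemma abs_class_deviation_le_1:
  assumes "1 \<le> R" "R \<le> M"
  shows "\<bar>class_deviation M R N\<bar> \<le> 1"
proof -
  have M: "real M > 0"
    using assms by simp
  define q where "q = (N + M - R) div M"
  have "q * M \<le> N + M - R" "N + M - R < q * M + M"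
    using M dividend_less_div_times [of M "N + M - R"]
    by (simp_all add: q_def mult.commute add.commute)
  then have "q * M + R \<le> N + M" "N < q * M + R"
    using assms by linarith+
  then have "real (q * M + R) \<le> real (N + M)" "real N < real (q * M + R)"
    by linarith+
  then have "real q * real M \<le> real N + real M" "real N \<le> real q * real M + real M"
    using assms by simp_all
  then have "real q - real N / real M \<le> 1" "real N / real M - real q \<le> 1"
    using M by (simp_all add: field_simps)
  then show ?thesis
    using class_deviation_eq [OF assms, of N] by (simp add: q_def)
qed

text \<open>The deviation has period \<open>M\<close> in \<open>N\<close>, and one period sums to
  \<open>(M + 1) / 2 - R\<close>. Its mean is thus about \<open>1 / 2 - R / M\<close>, which is
  positive for small \<open>R\<close>.\<close>

lemma sum_class_deviation:
  assumes "1 \<le> R" "R \<le> M"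
  shows "(\<Sum>N=1..M * q. class_deviation M R N) = real q * ((real M + 1) / 2 - real R)"
proof (induction q)
  case (Suc q)
  have periodic: "class_deviation M R (N + M * q) = class_deviation M R N" for N
  proof -
    have "N + M * q + M - R = (N + M - R) + M * q"
      using assms by simp
    then have "(N + M * q + M - R) div M = q + (N + M - R) div M"
      using assms by (simp only: div_mult_self2)
    then show ?thesis
      using assms by (simp add: class_deviation_eq add_divide_distrib)
  qed
  \<comment> \<open>In the first period the only member of the class is \<open>R\<close>.\<close>
  have "(\<Sum>N=1..M. class_deviation M R N) = (\<Sum>N=1..M. of_bool (R \<le> N) - real N / real M)"
  proof (rule sum.cong)
    fix N assume N: "N \<in> {1..M}"
    have "(N + M - R) div M = of_bool (R \<le> N)"
    proof (cases "R \<le> N")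
      case True
      then have "N + M - R = (N - R) + M" by simp
      moreover have "((N - R) + M) div M = (N - R) div M + 1"
        using assms by (intro div_add_self2) simp
      moreover have "(N - R) div M = 0"
        using N assms by (intro div_less) auto
      ultimately show ?thesis using True by simp
    next
      case False
      then show ?thesis using N assms by simp
    qed
    then show "class_deviation M R N = of_bool (R \<le> N) - real N / real M"
      using assms by (simp add: class_deviation_eq)
  qed simp
  also have "\<dots> = real (M + 1 - R) - (real M + 1) / 2"
  proof -
    have "{1..M} \<inter> {N. R \<le> N} = {R..M}"
      using assms by auto
    then have "(\<Sum>N=1..M. of_bool (R \<le> N)) = real (M + 1 - R)"
      by (simp add: sum_of_bool_eq)
    moreover have "(\<Sum>N=1..M. real N / real M) = (real M + 1) / 2"
    proof -
      have "(\<Sum>N=1..M. real N) = real M * (real M + 1) / 2"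
        using double_gauss_sum_from_Suc_0 [of M, where 'a = real] by simp
      then show ?thesis
        using assms by (simp flip: sum_divide_distrib)
    qed
    ultimately show ?thesis
      by (simp only: sum_subtractf)
  qed
  finally have period: "(\<Sum>N=1..M. class_deviation M R N) = (real M + 1) / 2 - real R"
    using assms by (simp add: of_nat_diff field_simps)
  have "(\<Sum>N=1..M * Suc q. class_deviation M R N)
      = (\<Sum>N=1..M * q. class_deviation M R N)
        + (\<Sum>N=1 + M * q..M + M * q. class_deviation M R N)"
    using sum.ub_add_nat [of 1 "M * q" "class_deviation M R" M] by (simp add: add.commute)
  also have "(\<Sum>N=1 + M * q..M + M * q. class_deviation M R N)
      = (\<Sum>N=1..M. class_deviation M R N)"
    unfolding sum.shift_bounds_cl_nat_ivl periodic ..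
  finally show ?case
    using Suc period by (simp add: algebra_simps)
qed simp

section \<open>Residues of the rational \<open>r - p / 5\<close> and of the product classes\<close>

lemma coprime_5_if_mult_mod: "e * B mod 5 = 1 \<Longrightarrow> coprime 5 B" for e B :: nat
  by (rule prime_imp_coprime) (auto elim!: dvdE)

text \<open>The equation for \<open>Z\<close> says that \<open>Z\<close> agrees with the rational \<open>r - p / 5\<close> modulo \<open>P\<close>;
  this makes its residues modulo divisors of \<open>P\<close> explicit.\<close>

lemma mod_of_rational:
  fixes Z r p P B e :: nat
  assumes Z: "5 * Z + p = 5 * r + P" and r: "r < p" and p: "p mod 5 = 1"
    and B: "100 * p \<le> B" "B dvd P" and e: "e * B mod 5 = 1" "1 \<le> e" "e \<le> 4"
  shows "5 * (Z mod B) + p = 5 * r + e * B"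
proof -
  have eB: "B \<le> e * B" "e * B \<le> 4 * B"
    using e by auto
  \<comment> \<open>Both terms are 1 modulo 5. Hence \<open>V = r - p / 5 + e * B / 5\<close> is an
    integer, congruent to the rational modulo \<open>B\<close>.\<close>
  have "5 dvd e * B - p"
    using mod_eq_dvd_iff_nat [of p "e * B" 5] eB B e p by simp
  then obtain w where w: "e * B - p = 5 * w" ..
  define V where "V = r + w"
  have V: "5 * V + p = 5 * r + e * B"
  proof -
    have "p \<le> e * B"
      using eB(1) B(1) by linarith
    with w have "e * B = 5 * w + p"
      by (metis le_add_diff_inverse2)
    then show ?thesis by (simp add: V_def)
  qed
  \<comment> \<open>Here \<open>5 * V < 4 * p + 4 * B\<close>, and \<open>p\<close> is at most
    \<open>B / 100\<close>.\<close>
  have "V < B"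
    using V r B eB by linarith
  have "int B dvd 5 * (int Z - int V)"
  proof -
    have "5 * (int Z - int V) = int P - int e * int B"
      using Z V by (simp add: algebra_simps flip: of_nat_mult of_nat_add)
    also have "int B dvd \<dots>"
      using B by auto
    finally show ?thesis .
  qed
  moreover have "coprime (int B) 5"
    using coprime_5_if_mult_mod [OF e(1)] by (metis coprime_commute coprime_int_iff of_nat_numeral)
  ultimately have "int B dvd int Z - int V"
    using coprime_dvd_mult_right_iff by blast
  then have "Z mod B = V mod B"
    by (metis mod_eq_dvd_iff of_nat_eq_iff zmod_int)
  then show ?thesis
    using V \<open>V < B\<close> by simp
qed

text \<open>With \<open>m = 2 ^ i * 3 ^ j\<close>, a sixth of the modulus, the choice
  \<open>R = r - p / 5 + \<rho> * m / 5\<close> gives \<open>5 * (R - Z) = \<rho> * m - P\<close>.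
  The condition on \<open>\<rho>\<close> modulo 5 makes \<open>R\<close> an integer; those modulo 2
  and 3 produce the deficits 1 and \<open>\<delta>\<close>. As \<open>r\<close> and \<open>p\<close>
  are small against \<open>m\<close>, the ratio of \<open>R\<close> to \<open>6 * m\<close> is close
  to \<open>\<rho> / 30\<close>.\<close>

lemma product_class_residue:
  fixes Z r p P \<rho> \<delta> i j :: nat
  assumes Z: "5 * Z + p = 5 * r + P" and r: "r < p" and p: "p mod 5 = 1"
    and ij: "100 * p \<le> 2 ^ i * 3 ^ j" "2 ^ Suc i * 3 ^ Suc j dvd P"
    and \<rho>: "\<rho> * (2 ^ i * 3 ^ j) mod 5 = 1" "odd \<rho>" "\<rho> \<le> 29" "\<rho> * 2 ^ i mod 3 = \<delta> mod 3"
  obtains R where "1 \<le> R" "R \<le> 2 ^ Suc i * 3 ^ Suc j"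
    "real R / real (2 ^ Suc i * 3 ^ Suc j) \<le> real \<rho> / 30 + 1 / 100"
    "\<And>n. (n + 2 ^ i) mod 2 ^ Suc i = Z mod 2 ^ Suc i \<and>
         (n + \<delta> * 3 ^ j) mod 3 ^ Suc j = Z mod 3 ^ Suc j \<longleftrightarrow>
       n mod (2 ^ Suc i * 3 ^ Suc j) = R mod (2 ^ Suc i * 3 ^ Suc j)"
proof -
  define m :: nat where "m = 2 ^ i * 3 ^ j"
  have M: "2 ^ Suc i * 3 ^ Suc j = 6 * m"
    by (simp add: m_def)
  have pm: "100 * p \<le> m"
    using ij by (simp add: m_def)
  have rm: "m \<le> \<rho> * m" "\<rho> * m \<le> 29 * m"
    using \<rho> by (auto elim: oddE)
  have "5 dvd \<rho> * m - p"
    using mod_eq_dvd_iff_nat [of p "\<rho> * m" 5] rm(1) pm \<rho>(1) p by (simp flip: m_def)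
  then obtain w where w: "\<rho> * m - p = 5 * w" ..
  define R where "R = r + w"
  have R: "5 * R + p = 5 * r + \<rho> * m"
  proof -
    have "p \<le> \<rho> * m"
      using rm(1) pm by linarith
    with w have "\<rho> * m = 5 * w + p"
      by (metis le_add_diff_inverse2)
    then show ?thesis by (simp add: R_def)
  qed
  have two: "int (2 ^ Suc i) dvd int P" and three: "int (3 ^ Suc j) dvd int P"
    using ij(2) by (metis dvd_mult_left dvd_mult_right of_nat_dvd_iff)+
  have RZ: "5 * (int R - int Z) = int \<rho> * int m - int P"
    using Z R by (simp add: algebra_simps flip: of_nat_mult of_nat_add)
  have R2: "(R + 2 ^ i) mod 2 ^ Suc i = Z mod 2 ^ Suc i"
  proof -
    have "5 * (int (R + 2 ^ i) - int Z) = 2 ^ i * (int \<rho> * 3 ^ j + 5) - int P"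
      using RZ by (simp add: m_def algebra_simps)
    also have "int (2 ^ Suc i) dvd \<dots>"
    proof -
      have "even (int \<rho> * 3 ^ j + 5)"
        using \<rho>(2) by simp
      then have "2 ^ i * 2 dvd 2 ^ i * (int \<rho> * 3 ^ j + 5)"
        by (intro mult_dvd_mono dvd_refl)
      then show ?thesis
        using two by (intro dvd_diff) (simp_all add: mult.commute)
    qed
    finally have "int (2 ^ Suc i) dvd int (R + 2 ^ i) - int Z"
      by (subst (asm) coprime_dvd_mult_right_iff) (simp_all del: power_Suc)
    then show ?thesis
      by (metis mod_eq_dvd_iff of_nat_eq_iff zmod_int)
  qed
  have R3: "(R + \<delta> * 3 ^ j) mod 3 ^ Suc j = Z mod 3 ^ Suc j"
  proof -
    have "5 * (int (R + \<delta> * 3 ^ j) - int Z) = 3 ^ j * (int \<rho> * 2 ^ i + 5 * int \<delta>) - int P"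
      using RZ by (simp add: m_def algebra_simps)
    also have "int (3 ^ Suc j) dvd \<dots>"
    proof -
      have "3 dvd \<rho> * 2 ^ i + 5 * \<delta>"
        using \<rho>(4) by presburger
      then have "int 3 dvd int (\<rho> * 2 ^ i + 5 * \<delta>)"
        by (simp only: of_nat_dvd_iff)
      then have "3 dvd int \<rho> * 2 ^ i + 5 * int \<delta>"
        by simp
      then have "3 ^ j * 3 dvd 3 ^ j * (int \<rho> * 2 ^ i + 5 * int \<delta>)"
        by (intro mult_dvd_mono dvd_refl)
      then show ?thesis
        using three by (intro dvd_diff) (simp_all add: mult.commute)
    qed
    finally have "int (3 ^ Suc j) dvd 5 * (int (R + \<delta> * 3 ^ j) - int Z)" .
    moreover have "coprime (3 :: int) 5"
    proof -
      have "coprime (5 :: nat) 3"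
        by (rule coprime_5_if_mult_mod [of 2]) simp
      then show ?thesis
        by (metis coprime_commute coprime_int_iff of_nat_numeral)
    qed
    ultimately have "int (3 ^ Suc j) dvd int (R + \<delta> * 3 ^ j) - int Z"
      by (subst (asm) coprime_dvd_mult_right_iff) (simp_all del: power_Suc)
    then show ?thesis
      by (metis mod_eq_dvd_iff of_nat_eq_iff zmod_int)
  qed
  have cop: "coprime (2 ^ Suc i) (3 ^ Suc j :: nat)"
    by (intro coprime_power_left_iff [THEN iffD2] disjI1 coprime_power_right_iff [THEN iffD2]) simp
  show thesis
  proof (rule that)
    show "1 \<le> R" "R \<le> 2 ^ Suc i * 3 ^ Suc j"
      unfolding M using R r rm pm by linarith+
    \<comment> \<open>The term \<open>r\<close> costs at most \<open>m / 100\<close>, less than the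
      \<open>6 * m / 100\<close> allowed.\<close>
    have "real R \<le> real \<rho> / 30 * real (6 * m) + 1 / 100 * real (6 * m)"
    proof -
      have "500 * R \<le> 100 * (\<rho> * m) + 5 * m"
        using R r pm by linarith
      then have "real (500 * R) \<le> real (100 * (\<rho> * m) + 5 * m)"
        by (rule of_nat_mono)
      then show ?thesis by simp
    qed
    moreover have "real (6 * m) > 0"
      using pm r by simp
    ultimately show "real R / real (2 ^ Suc i * 3 ^ Suc j) \<le> real \<rho> / 30 + 1 / 100"
      unfolding M by (simp add: field_simps)
    show "(n + 2 ^ i) mod 2 ^ Suc i = Z mod 2 ^ Suc i \<and>
         (n + \<delta> * 3 ^ j) mod 3 ^ Suc j = Z mod 3 ^ Suc j \<longleftrightarrow>
       n mod (2 ^ Suc i * 3 ^ Suc j) = R mod (2 ^ Suc i * 3 ^ Suc j)" for n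
      unfolding mod_mult_eq_iff_coprime_nat [OF cop] R2 [symmetric] R3 [symmetric]
        mod_add_right_cancel_nat ..
  qed
qed

section \<open>The rectangles and their average discrepancy\<close>

text \<open>An integer congruent to \<open>r - p / 5\<close> modulo \<open>6 ^ (16 * k)\<close>,
  where \<open>p = 6 ^ (4 * k)\<close>. Its lowest \<open>16 * k\<close> digits in base 2 and in
  base 3 are those of the two expansions of this one rational.\<close>

definition node :: "nat \<Rightarrow> nat \<Rightarrow> nat" where
  "node k r = r + (6 ^ (16 * k) - 6 ^ (4 * k)) div 5"

text \<open>In both bases the digits of \<^term>\<open>node k r\<close> in positions \<open>12 * k\<close> to \<open>16 * k - 1\<close> are
  those of \<open>-1 / 5\<close>: periodically 1, 1, 0, 0 in base 2 and 1, 2, 1, 0 in base 3.\<close>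

definition node_prefix :: "nat \<Rightarrow> nat \<Rightarrow> nat \<Rightarrow> nat \<Rightarrow> real" where
  "node_prefix b k r i = radical_inverse b (node k r mod b ^ i)"

text \<open>Since \<open>-1 / 5\<close> equals \<open>3 / (1 - 2 ^ 4)\<close> and
  \<open>16 / (1 - 3 ^ 4)\<close>, the periods are the digits of 3 in base 2 and, for
  \<open>digits3\<close>, of 16 in base 3.\<close>

definition digits2 :: "nat \<Rightarrow> nat" where
  "digits2 u = (if u \<le> 1 then 1 else 0)"

definition digits3 :: "nat \<Rightarrow> nat" where
  "digits3 u = (if u = 0 then 1 else if u = 1 then 2 else if u = 2 then 1 else 0)"

lemma power_6_mod_5: "6 ^ n mod 5 = (1 :: nat)"
  using power_mod [of "6 :: nat" 5 n] by simp

lemma node_eq: "5 * node k r + 6 ^ (4 * k) = 5 * r + 6 ^ (16 * k)"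
proof -
  have le: "6 ^ (4 * k) \<le> (6 :: nat) ^ (16 * k)"
    by (rule power_increasing) auto
  have "5 dvd (6 :: nat) ^ (16 * k) - 6 ^ (4 * k)"
    using mod_eq_dvd_iff_nat [OF le, of 5] by (simp add: power_6_mod_5)
  then have "5 * ((6 ^ (16 * k) - 6 ^ (4 * k)) div 5) = (6 :: nat) ^ (16 * k) - 6 ^ (4 * k)"
    by simp
  then have "5 * ((6 ^ (16 * k) - 6 ^ (4 * k)) div 5) + 6 ^ (4 * k) = (6 :: nat) ^ (16 * k)"
    using le by simp
  then show ?thesis
    unfolding node_def distrib_left by linarith
qed

text \<open>For bases 2 and 3, powers modulo 5 depend only on the exponent modulo 4.\<close>

lemma mult_power_block_mod_5:
  assumes "b ^ 4 mod 5 = (1 :: nat)"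
  shows "c * b ^ (12 * k + (4 * l + u)) mod 5 = c * b ^ u mod 5"
proof -
  have "b ^ (12 * k + (4 * l + u)) = (b ^ 4) ^ (3 * k + l) * b ^ u"
    by (simp add: power_mult [symmetric] power_add [symmetric] algebra_simps)
  moreover have "(b ^ 4) ^ (3 * k + l) mod 5 = 1"
    using assms power_mod [of "b ^ 4" 5 "3 * k + l"] by simp
  ultimately show ?thesis
    by (metis mod_mult_left_eq mod_mult_right_eq mult_1)
qed

text \<open>This fixes the block start \<open>12 * k\<close> and the bound on \<open>k\<close>:
  \<open>3 * 6 ^ 4 = 3888\<close> is below \<open>2 ^ 12 = 4096\<close>, and \<open>3 ^ 5\<close>
  exceeds 100.\<close>

lemma power_12_ge:
  assumes "k \<ge> 5" "b \<ge> 2"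
  shows "100 * 6 ^ (4 * k) \<le> (b :: nat) ^ (12 * k + i)"
proof -
  have "(3 :: nat) ^ 5 \<le> 3 ^ k"
    using assms(1) by (rule power_increasing) simp
  then have "100 * (6 :: nat) ^ (4 * k) \<le> 3 ^ k * 6 ^ (4 * k)"
    by simp
  also have "\<dots> = (3 * 6 ^ 4) ^ k"
    by (simp only: power_mult power_mult_distrib)
  also have "\<dots> \<le> (2 ^ 12) ^ k"
    by (rule power_mono) simp_all
  also have "\<dots> = 2 ^ (12 * k)"
    by (simp add: power_mult)
  also have "\<dots> \<le> b ^ (12 * k)"
    using assms(2) by (intro power_mono) auto
  also have "\<dots> \<le> b ^ (12 * k + i)"
    using assms(2) by (intro power_increasing) auto
  finally show ?thesis .
qed

lemma power_2_3_dvd_6: "i \<le> n \<Longrightarrow> j \<le> n \<Longrightarrow> 2 ^ i * 3 ^ j dvd (6 :: nat) ^ n"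
proof -
  assume "i \<le> n" "j \<le> n"
  then have "2 ^ i * 3 ^ j dvd (2 :: nat) ^ n * 3 ^ n"
    by (intro mult_dvd_mono le_imp_power_dvd)
  then show ?thesis
    by (simp flip: power_mult_distrib)
qed

text \<open>The numbers \<open>e\<close> and \<open>e'\<close> invert \<open>b ^ u\<close> and
  \<open>b ^ Suc u\<close> modulo 5, so \<open>mod_of_rational\<close> gives two consecutive
  truncations explicitly. They differ by \<open>(e' * b - e) / 5 = z\<close> times the power of
  \<open>b\<close>.\<close>

lemma node_digit:
  fixes b e e' z :: nat
  assumes k: "k \<ge> 5" and r: "r < 6 ^ (4 * k)" and l: "l < k" and u: "u < 4"
    and b: "b = 2 \<or> b = 3"
    and e: "e * b ^ u mod 5 = 1" "1 \<le> e" "e \<le> 4"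
    and e': "e' * b ^ Suc u mod 5 = 1" "1 \<le> e'" "e' \<le> 4"
    and z: "e' * b = e + 5 * z"
  shows "node k r mod b ^ Suc (12 * k + (4 * l + u))
    = node k r mod b ^ (12 * k + (4 * l + u)) + z * b ^ (12 * k + (4 * l + u))"
proof -
  let ?i = "12 * k + (4 * l + u)"
  have b4: "b ^ 4 mod 5 = 1"
    using b by auto
  have b2: "b \<ge> 2"
    using b by auto
  have dvd: "b ^ j dvd 6 ^ (16 * k)" if "j \<le> 16 * k" for j
    using b power_2_3_dvd_6 [OF that, of 0] power_2_3_dvd_6 [OF _ that, of 0] by auto
  have "Suc ?i \<le> 16 * k"
    using l u by simp
  note * = mod_of_rational [OF node_eq r power_6_mod_5 power_12_ge [OF k b2] dvd]
  have 1: "5 * (node k r mod b ^ ?i) + 6 ^ (4 * k) = 5 * r + e * b ^ ?i"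
    using \<open>Suc ?i \<le> 16 * k\<close> e by (intro *) (simp_all add: mult_power_block_mod_5 [OF b4])
  have 2: "5 * (node k r mod b ^ (12 * k + (4 * l + Suc u))) + 6 ^ (4 * k)
      = 5 * r + e' * b ^ (12 * k + (4 * l + Suc u))"
    using \<open>Suc ?i \<le> 16 * k\<close> e' mult_power_block_mod_5 [OF b4, of e' k l "Suc u"]
    by (intro *) simp_all
  have "e' * b ^ (12 * k + (4 * l + Suc u)) = (e' * b) * b ^ ?i"
    by simp
  also have "\<dots> = e * b ^ ?i + 5 * (z * b ^ ?i)"
    unfolding z by (simp add: algebra_simps)
  finally have "5 * (node k r mod b ^ (12 * k + (4 * l + Suc u))) + 6 ^ (4 * k)
      = 5 * (node k r mod b ^ ?i + z * b ^ ?i) + 6 ^ (4 * k)"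
    using 1 2 by (simp only: distrib_left add.assoc add.commute add.left_commute)
  then show ?thesis
    by simp
qed

lemma less_4_cases: "u < 4 \<Longrightarrow> u = 0 \<or> u = 1 \<or> u = 2 \<or> u = (3 :: nat)"
  by linarith

lemma node_digit2:
  assumes "k \<ge> 5" "r < 6 ^ (4 * k)" "i < 4 * k"
  shows "node k r mod 2 ^ Suc (12 * k + i)
    = node k r mod 2 ^ (12 * k + i) + digits2 (i mod 4) * 2 ^ (12 * k + i)"
proof -
  define l u where "l = i div 4" and "u = i mod 4"
  have i: "i = 4 * l + u" "l < k" "u < 4"
    using assms(3) by (auto simp: l_def u_def less_mult_imp_div_less)
  note * = node_digit [OF assms(1,2) i(2,3)]
  show ?thesis
    \<comment> \<open>The inverses of 1, 2, 4, 8, 16 modulo 5 are 1, 3, 4, 2, 1. Each instance lists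
      the base, two consecutive inverses and the digit \<open>(2 * e' - e) / 5\<close>.\<close>
    using less_4_cases [OF i(3)] *[of 2 1 3 1] *[of 2 3 4 1] *[of 2 4 2 0] *[of 2 2 1 0]
    unfolding u_def [symmetric] unfolding i(1) by (elim disjE) (simp_all add: digits2_def)
qed

lemma node_digit3:
  assumes "k \<ge> 5" "r < 6 ^ (4 * k)" "i < 4 * k"
  shows "node k r mod 3 ^ Suc (12 * k + i)
    = node k r mod 3 ^ (12 * k + i) + digits3 (i mod 4) * 3 ^ (12 * k + i)"
proof -
  define l u where "l = i div 4" and "u = i mod 4"
  have i: "i = 4 * l + u" "l < k" "u < 4"
    using assms(3) by (auto simp: l_def u_def less_mult_imp_div_less)
  note * = node_digit [OF assms(1,2) i(2,3)]
  show ?thesis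
    \<comment> \<open>For the powers of 3 the inverses are 1, 2, 4, 3, 1 and the digit is
      \<open>(3 * e' - e) / 5\<close>.\<close>
    using less_4_cases [OF i(3)] *[of 3 1 2 1] *[of 3 2 4 2] *[of 3 4 3 1] *[of 3 3 1 0]
    unfolding u_def [symmetric] unfolding i(1) by (elim disjE) (simp_all add: digits3_def)
qed

section \<open>The box discrepancy as a sum over pairs of residue classes\<close>

definition box_discrepancy :: "nat \<Rightarrow> nat \<Rightarrow> nat \<Rightarrow> real" where
  "box_discrepancy k r N = (\<Sum>n=1..N.
     indicator {node_prefix 2 k r (12 * k)..<node_prefix 2 k r (16 * k)} (radical_inverse 2 n) *
     indicator {node_prefix 3 k r (12 * k)..<node_prefix 3 k r (16 * k)} (radical_inverse 3 n) -
     (node_prefix 2 k r (16 * k) - node_prefix 2 k r (12 * k)) *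
     (node_prefix 3 k r (16 * k) - node_prefix 3 k r (12 * k)))"

text \<open>A product class, with base 2 position \<open>u\<close> and base 3 position \<open>v\<close> modulo 4 and ternary digit
  lowered by \<open>\<delta>\<close>, has its residue at about \<open>class_numerator u v \<delta> / 30\<close> of its modulus. The
  value is the solution \<open>\<rho> < 30\<close> of the congruences modulo 2, 3 and 5 in
  \<open>product_class_residue\<close>. The eight values add up to \<open>96 < 120 = 8 * 30 / 2\<close>, which is the
  source of the bias.\<close>

definition class_numerator :: "nat \<Rightarrow> nat \<Rightarrow> nat \<Rightarrow> nat" where
  "class_numerator u v \<delta> =
     (if u = 0 then (if v = 0 then 1 else if v = 1 then (if \<delta> = 1 then 7 else 17) else 19)
      else (if v = 0 then 23 else if v = 1 then (if \<delta> = 1 then 11 else 1) else 17))"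

definition in_class :: "nat \<Rightarrow> nat \<Rightarrow> nat \<Rightarrow> nat \<times> nat \<times> nat \<Rightarrow> nat \<Rightarrow> bool" where
  "in_class b k r = (\<lambda>(l, u, \<delta>) n.
     (n + \<delta> * b ^ (12 * k + (4 * l + u))) mod b ^ Suc (12 * k + (4 * l + u))
       = node k r mod b ^ Suc (12 * k + (4 * l + u)))"

definition class_size :: "nat \<Rightarrow> nat \<Rightarrow> nat \<times> nat \<times> nat \<Rightarrow> nat" where
  "class_size b k = (\<lambda>(l, u, \<delta>). b ^ Suc (12 * k + (4 * l + u)))"

lemma node_prefix_digits:
  assumes "k \<ge> 5" "r < 6 ^ (4 * k)"
  shows "indicator {node_prefix 2 k r (12 * k)..<node_prefix 2 k r (16 * k)} (radical_inverse 2 n)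
      = (\<Sum>x\<in>digit_index k digits2. of_bool (in_class 2 k r x n) :: real)"
    and "indicator {node_prefix 3 k r (12 * k)..<node_prefix 3 k r (16 * k)} (radical_inverse 3 n)
      = (\<Sum>x\<in>digit_index k digits3. of_bool (in_class 3 k r x n) :: real)"
    and "node_prefix 2 k r (16 * k) - node_prefix 2 k r (12 * k)
      = (\<Sum>x\<in>digit_index k digits2. 1 / real (class_size 2 k x))"
    and "node_prefix 3 k r (16 * k) - node_prefix 3 k r (12 * k)
      = (\<Sum>x\<in>digit_index k digits3. 1 / real (class_size 3 k x))"
    and "node_prefix 2 k r (12 * k) \<le> node_prefix 2 k r (16 * k)"
    and "node_prefix 3 k r (12 * k) \<le> node_prefix 3 k r (16 * k)"
proof -
  have [simp]: "12 * k + 4 * k = 16 * k"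
    by simp
  note 2 = radical_inverse_periodic_digits [where b = 2 and k = k, OF _ node_digit2 [OF assms], simplified]
  note 3 = radical_inverse_periodic_digits [where b = 3 and k = k, OF _ node_digit3 [OF assms], simplified]
  show "indicator {node_prefix 2 k r (12 * k)..<node_prefix 2 k r (16 * k)} (radical_inverse 2 n)
      = (\<Sum>x\<in>digit_index k digits2. of_bool (in_class 2 k r x n) :: real)"
    using 2(1) by (simp add: node_prefix_def in_class_def split_def)
  show "indicator {node_prefix 3 k r (12 * k)..<node_prefix 3 k r (16 * k)} (radical_inverse 3 n)
      = (\<Sum>x\<in>digit_index k digits3. of_bool (in_class 3 k r x n) :: real)"
    using 3(1) by (simp add: node_prefix_def in_class_def split_def)
  show "node_prefix 2 k r (16 * k) - node_prefix 2 k r (12 * k)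
      = (\<Sum>x\<in>digit_index k digits2. 1 / real (class_size 2 k x))"
    using 2(2) by (simp add: node_prefix_def class_size_def split_def)
  show "node_prefix 3 k r (16 * k) - node_prefix 3 k r (12 * k)
      = (\<Sum>x\<in>digit_index k digits3. 1 / real (class_size 3 k x))"
    using 3(2) by (simp add: node_prefix_def class_size_def split_def)
  show "node_prefix 2 k r (12 * k) \<le> node_prefix 2 k r (16 * k)"
    using 2(3) by (simp add: node_prefix_def)
  show "node_prefix 3 k r (12 * k) \<le> node_prefix 3 k r (16 * k)"
    using 3(3) by (simp add: node_prefix_def)
qed

text \<open>The indicator and the area factor over the same index sets, so each pair of classes
  receives its own share of the area.\<close>

lemma box_discrepancy_eq:
  assumes "k \<ge> 5" "r < 6 ^ (4 * k)"
  shows "box_discrepancy k r N = (\<Sum>x\<in>digit_index k digits2. \<Sum>y\<in>digit_index k digits3.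
    \<Sum>n=1..N. of_bool (in_class 2 k r x n \<and> in_class 3 k r y n)
      - 1 / real (class_size 2 k x * class_size 3 k y))"
proof -
  have "box_discrepancy k r N = (\<Sum>n=1..N.
      \<Sum>x\<in>digit_index k digits2. \<Sum>y\<in>digit_index k digits3.
        of_bool (in_class 2 k r x n) * of_bool (in_class 3 k r y n)
        - 1 / real (class_size 2 k x) * (1 / real (class_size 3 k y)))"
    unfolding box_discrepancy_def node_prefix_digits [OF assms] sum_product sum_subtractf ..
  also have "\<dots> = (\<Sum>n=1..N.
      \<Sum>x\<in>digit_index k digits2. \<Sum>y\<in>digit_index k digits3.
        of_bool (in_class 2 k r x n \<and> in_class 3 k r y n)
        - 1 / real (class_size 2 k x * class_size 3 k y))"
    by (simp only: of_bool_conj times_divide_times_eq mult_1 of_nat_mult)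
  also have "\<dots> = (\<Sum>x\<in>digit_index k digits2. \<Sum>y\<in>digit_index k digits3.
    \<Sum>n=1..N. of_bool (in_class 2 k r x n \<and> in_class 3 k r y n)
      - 1 / real (class_size 2 k x * class_size 3 k y))"
    by (subst sum.swap, rule sum.cong, rule refl, subst sum.swap, rule refl)
  finally show ?thesis .
qed

lemma class_residue:
  assumes k: "k \<ge> 5" and r: "r < 6 ^ (4 * k)"
    and x: "(l, u, \<delta>) \<in> digit_index k digits2" and y: "(l', v, \<epsilon>) \<in> digit_index k digits3"
  defines "M \<equiv> class_size 2 k (l, u, \<delta>) * class_size 3 k (l', v, \<epsilon>)"
  obtains R where "1 \<le> R" "R \<le> M" "M dvd 6 ^ (16 * k)"
    "real R / real M \<le> real (class_numerator u v \<epsilon>) / 30 + 1 / 100"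
    "\<And>n. in_class 2 k r (l, u, \<delta>) n \<and> in_class 3 k r (l', v, \<epsilon>) n \<longleftrightarrow> n mod M = R mod M"
proof -
  let ?i = "12 * k + (4 * l + u)" and ?j = "12 * k + (4 * l' + v)"
  have u: "u = 0 \<or> u = 1" "\<delta> = 1" and l: "l < k" "l' < k"
    using x y by (auto simp: digit_index_def digits2_def split: if_splits)
  have v: "(v = 0 \<and> \<epsilon> = 1) \<or> (v = 1 \<and> \<epsilon> = 1) \<or> (v = 1 \<and> \<epsilon> = 2) \<or> (v = 2 \<and> \<epsilon> = 1)"
    using y by (auto simp: digit_index_def digits3_def split: if_splits)
  have dvd: "2 ^ Suc ?i * 3 ^ Suc ?j dvd (6 :: nat) ^ (16 * k)"
    using u v l by (intro power_2_3_dvd_6) auto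
  have ge: "100 * 6 ^ (4 * k) \<le> (2 :: nat) ^ ?i * 3 ^ ?j"
    using power_12_ge [OF k, of 2 "4 * l + u"] by (simp add: order_trans)
  let ?\<rho> = "class_numerator u v \<epsilon>"
  have mod5: "?\<rho> * (2 ^ ?i * 3 ^ ?j) mod 5 = 1"
  proof -
    have "?\<rho> * (2 ^ ?i * 3 ^ ?j) mod 5 = (?\<rho> * 2 ^ ?i) * 3 ^ v mod 5"
      using mult_power_block_mod_5 [of 3 "?\<rho> * 2 ^ ?i" k l' v] by (simp add: mult.assoc)
    also have "\<dots> = (?\<rho> * 3 ^ v) * 2 ^ u mod 5"
      using mult_power_block_mod_5 [of 2 "?\<rho> * 3 ^ v" k l u] by (simp add: mult_ac)
    also have "\<dots> = 1"
      using u v by (elim disjE conjE) (simp_all add: class_numerator_def)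
    finally show ?thesis .
  qed
  \<comment> \<open>The exponent \<open>12 * k + 4 * l\<close> is even, and 4 is 1 modulo 3.\<close>
  have "2 ^ ?i mod 3 = (2 ^ u :: nat) mod 3"
  proof -
    have "(2 :: nat) ^ ?i = 4 ^ (6 * k + 2 * l) * 2 ^ u"
      by (simp add: power_add power_mult)
    moreover have "(4 :: nat) ^ (6 * k + 2 * l) mod 3 = 1"
      using power_mod [of "4 :: nat" 3 "6 * k + 2 * l"] by simp
    ultimately show ?thesis
      by (metis mod_mult_left_eq mult_1)
  qed
  then have "?\<rho> * 2 ^ ?i mod 3 = ?\<rho> * 2 ^ u mod 3"
    by (metis mod_mult_right_eq)
  also have "\<dots> = \<epsilon> mod 3"
    using u v by (elim disjE conjE) (simp_all add: class_numerator_def)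
  finally have mod3: "?\<rho> * 2 ^ ?i mod 3 = \<epsilon> mod 3" .
  have \<rho>: "odd ?\<rho>" "?\<rho> \<le> 29"
    using u v by (auto simp: class_numerator_def)
  from product_class_residue [OF node_eq r power_6_mod_5 ge dvd mod5 \<rho> mod3]
  obtain R where R: "1 \<le> R" "R \<le> 2 ^ Suc ?i * 3 ^ Suc ?j"
    "real R / real (2 ^ Suc ?i * 3 ^ Suc ?j) \<le> real ?\<rho> / 30 + 1 / 100"
    "\<And>n. (n + 2 ^ ?i) mod 2 ^ Suc ?i = node k r mod 2 ^ Suc ?i \<and>
         (n + \<epsilon> * 3 ^ ?j) mod 3 ^ Suc ?j = node k r mod 3 ^ Suc ?j \<longleftrightarrow>
       n mod (2 ^ Suc ?i * 3 ^ Suc ?j) = R mod (2 ^ Suc ?i * 3 ^ Suc ?j)"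
    by blast
  show thesis
  proof (rule that)
    show "1 \<le> R" by fact
    show "R \<le> M" "M dvd 6 ^ (16 * k)" "real R / real M \<le> real ?\<rho> / 30 + 1 / 100"
      using R(2,3) dvd by (simp_all only: M_def class_size_def prod.case)
    show "in_class 2 k r (l, u, \<delta>) n \<and> in_class 3 k r (l', v, \<epsilon>) n \<longleftrightarrow> n mod M = R mod M" for n
      using R(4) [of n] by (simp only: M_def class_size_def in_class_def prod.case u(2) mult_1)
  qed
qed

text \<open>The modulus divides \<open>6 ^ (16 * k)\<close>, so the sum over \<open>N\<close>
  consists of whole periods. The constant \<open>49 / 100\<close> is \<open>1 / 2\<close> less the
  error \<open>1 / 100\<close> in \<open>R / M\<close>.\<close>

lemma class_pair_bounds:
  assumes "k \<ge> 5" "r < 6 ^ (4 * k)"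
    and "(l, u, \<delta>) \<in> digit_index k digits2" "(l', v, \<epsilon>) \<in> digit_index k digits3"
  defines "f \<equiv> \<lambda>N. \<Sum>n=1..N.
      of_bool (in_class 2 k r (l, u, \<delta>) n \<and> in_class 3 k r (l', v, \<epsilon>) n)
      - 1 / real (class_size 2 k (l, u, \<delta>) * class_size 3 k (l', v, \<epsilon>))"
  shows "\<bar>f N\<bar> \<le> 1"
    and "(\<Sum>N=1..6 ^ (16 * k). f N) \<ge> 6 ^ (16 * k) * (49 / 100 - real (class_numerator u v \<epsilon>) / 30)"
proof -
  define M where "M = class_size 2 k (l, u, \<delta>) * class_size 3 k (l', v, \<epsilon>)"
  obtain R where R: "1 \<le> R" "R \<le> M" "M dvd 6 ^ (16 * k)"
    "real R / real M \<le> real (class_numerator u v \<epsilon>) / 30 + 1 / 100"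
    "\<And>n. in_class 2 k r (l, u, \<delta>) n \<and> in_class 3 k r (l', v, \<epsilon>) n \<longleftrightarrow> n mod M = R mod M"
    using class_residue [OF assms(1-4)] unfolding M_def by blast
  have f: "f = class_deviation M R"
    unfolding f_def class_deviation_def R(5) M_def ..
  show "\<bar>f N\<bar> \<le> 1"
    unfolding f by (rule abs_class_deviation_le_1 [OF R(1,2)])
  obtain q where q: "6 ^ (16 * k) = M * q"
    using R(3) by (elim dvdE)
  then have q': "(6 :: real) ^ (16 * k) = real M * real q"
    by (metis of_nat_mult of_nat_numeral of_nat_power)
  have M: "real M > 0"
    using R by simp
  have "6 ^ (16 * k) * (49 / 100 - real (class_numerator u v \<epsilon>) / 30)
      \<le> 6 ^ (16 * k) * (1 / 2 - real R / real M)"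
    using R(4) by (intro mult_left_mono) simp_all
  also have "\<dots> = real q * (real M / 2 - real R)"
    using M unfolding q' by (simp add: field_simps)
  also have "\<dots> \<le> real q * ((real M + 1) / 2 - real R)"
    by (intro mult_left_mono) (simp_all add: field_simps)
  also have "\<dots> = (\<Sum>N=1..6 ^ (16 * k). f N)"
    unfolding f q sum_class_deviation [OF R(1,2)] ..
  finally show "(\<Sum>N=1..6 ^ (16 * k). f N)
      \<ge> 6 ^ (16 * k) * (49 / 100 - real (class_numerator u v \<epsilon>) / 30)" .
qed

text \<open>There are \<open>2 * k\<close> classes in base 2 and \<open>4 * k\<close> in base 3,
  hence \<open>8 * k ^ 2\<close> pairs, each contributing at most 1. The mean is at least
  \<open>8 * 49 / 100 - 96 / 30 = 0.72\<close> times \<open>k ^ 2\<close>.\<close>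

lemma box_discrepancy_bounds:
  assumes k: "k \<ge> 5" and r: "r < 6 ^ (4 * k)"
  shows "box_discrepancy k r N \<le> 8 * (real k)\<^sup>2"
    and "(\<Sum>N=1..6 ^ (16 * k). box_discrepancy k r N) \<ge> 6 ^ (16 * k) * (7 / 10 * (real k)\<^sup>2)"
proof -
  define f where "f x y N = (\<Sum>n=1..N. of_bool (in_class 2 k r x n \<and> in_class 3 k r y n)
      - 1 / real (class_size 2 k x * class_size 3 k y))" for x y N
  have D: "box_discrepancy k r N
      = (\<Sum>x\<in>digit_index k digits2. \<Sum>y\<in>digit_index k digits3. f x y N)" for N
    unfolding f_def by (rule box_discrepancy_eq [OF assms])
  have lessThan_4: "{..<4::nat} = {0, 1, 2, 3}"
    by auto
  have sum2: "(\<Sum>(l, u, \<delta>)\<in>digit_index k digits2. g u \<delta>) = real k * (g 0 1 + g 1 1)"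
    for g :: "nat \<Rightarrow> nat \<Rightarrow> real"
    unfolding digit_index_def
    by (subst sum.Sigma [symmetric], simp, simp, subst sum.Sigma [symmetric])
      (simp_all add: lessThan_4 digits2_def)
  have sum3: "(\<Sum>(l, u, \<delta>)\<in>digit_index k digits3. g u \<delta>) = real k * (g 0 1 + g 1 1 + g 1 2 + g 2 1)"
    for g :: "nat \<Rightarrow> nat \<Rightarrow> real"
    unfolding digit_index_def
    by (subst sum.Sigma [symmetric], simp, simp, subst sum.Sigma [symmetric])
      (simp_all add: lessThan_4 digits3_def numeral_2_eq_2)
  have "f x y N \<le> 1" if "x \<in> digit_index k digits2" "y \<in> digit_index k digits3" for x y
    using class_pair_bounds(1) [OF assms, of "fst x" "fst (snd x)" "snd (snd x)"
        "fst y" "fst (snd y)" "snd (snd y)" N] that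
    unfolding f_def by simp
  then have "box_discrepancy k r N
      \<le> (\<Sum>x\<in>digit_index k digits2. \<Sum>y\<in>digit_index k digits3. 1)"
    unfolding D by (intro sum_mono)
  also have "\<dots> = 8 * (real k)\<^sup>2"
    using sum2 [of "\<lambda>u \<delta>. 4 * real k"] sum3 [of "\<lambda>u \<delta>. 1"]
    by (simp add: split_def power2_eq_square)
  finally show "box_discrepancy k r N \<le> 8 * (real k)\<^sup>2" .
  have "6 ^ (16 * k) * (7 / 10 * (real k)\<^sup>2) \<le> (\<Sum>(l, u, \<delta>)\<in>digit_index k digits2.
      \<Sum>(l', v, \<epsilon>)\<in>digit_index k digits3.
        6 ^ (16 * k) * (49 / 100 - real (class_numerator u v \<epsilon>) / 30))"
    unfolding sum3 sum2 [of "\<lambda>u \<delta>. real k * (G u)" for G]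
    by (simp add: class_numerator_def power2_eq_square algebra_simps)
  also have "\<dots> \<le> (\<Sum>x\<in>digit_index k digits2. \<Sum>y\<in>digit_index k digits3.
      \<Sum>N=1..6 ^ (16 * k). f x y N)"
    using class_pair_bounds(2) [OF assms]
    unfolding f_def by (auto intro!: sum_mono simp: split_def)
  also have "\<dots> = (\<Sum>x\<in>digit_index k digits2. \<Sum>N=1..6 ^ (16 * k).
      \<Sum>y\<in>digit_index k digits3. f x y N)"
    by (intro sum.cong refl sum.swap)
  also have "\<dots> = (\<Sum>N=1..6 ^ (16 * k). box_discrepancy k r N)"
    unfolding D by (rule sum.swap)
  finally show "(\<Sum>N=1..6 ^ (16 * k). box_discrepancy k r N)
      \<ge> 6 ^ (16 * k) * (7 / 10 * (real k)\<^sup>2)" .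
qed

section \<open>Cells and the choice of \<open>N\<close>\<close>

definition cell :: "nat \<Rightarrow> nat \<Rightarrow> (real \<times> real) set" where
  "cell k r =
     {radical_inverse 2 (r mod 2 ^ (4 * k))..<radical_inverse 2 (r mod 2 ^ (4 * k)) + 1 / 2 ^ (4 * k)} \<times>
     {radical_inverse 3 (r mod 3 ^ (4 * k))..<radical_inverse 3 (r mod 3 ^ (4 * k)) + 1 / 3 ^ (4 * k)}"

text \<open>Both powers of 6 in \<open>node_eq\<close> vanish modulo \<open>b ^ (4 * k)\<close>, and
  5 is invertible there.\<close>

lemma node_mod_prefix:
  assumes "b = 2 \<or> b = (3 :: nat)"
  shows "node k r mod b ^ (4 * k) = r mod b ^ (4 * k)"
proof -
  have dvd: "b ^ (4 * k) dvd 6 ^ (4 * k)" "b ^ (4 * k) dvd 6 ^ (16 * k)"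
    using assms power_2_3_dvd_6 [of "4 * k" _ 0] power_2_3_dvd_6 [of 0 _ "4 * k"] by auto
  have "5 * int (node k r) + int (6 ^ (4 * k)) = 5 * int r + int (6 ^ (16 * k))"
    using arg_cong [OF node_eq [of k r], of int] by simp
  then have "5 * (int (node k r) - int r) = int (6 ^ (16 * k)) - int (6 ^ (4 * k))"
    by (simp only: right_diff_distrib)
  also have "int (b ^ (4 * k)) dvd \<dots>"
    using dvd by (intro dvd_diff) (simp_all only: of_nat_dvd_iff)
  finally have "int (b ^ (4 * k)) dvd 5 * (int (node k r) - int r)" .
  moreover have "coprime (int (b ^ (4 * k))) 5"
  proof -
    have "b ^ 4 mod 5 = 1"
      using assms by auto
    then have "(b ^ 4) ^ k mod 5 = 1"
      using power_mod [of "b ^ 4" 5 k] by simp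
    then have "1 * b ^ (4 * k) mod 5 = 1"
      by (simp only: power_mult mult_1)
    from coprime_5_if_mult_mod [OF this] show ?thesis
      by (metis coprime_commute coprime_int_iff of_nat_numeral)
  qed
  ultimately have "int (b ^ (4 * k)) dvd int (node k r) - int r"
    using coprime_dvd_mult_right_iff by blast
  then show ?thesis
    by (metis mod_eq_dvd_iff of_nat_eq_iff zmod_int)
qed

text \<open>Truncation after at least \<open>4 * k\<close> digits keeps the digits that fix the
  cell, so all corners of the rectangle lie in its cell.\<close>

lemma node_prefix_mem:
  assumes "b = 2 \<or> b = (3 :: nat)" "4 * k \<le> i"
  shows "node_prefix b k r i \<in> {radical_inverse b (r mod b ^ (4 * k))..<
           radical_inverse b (r mod b ^ (4 * k)) + 1 / real b ^ (4 * k)}"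
proof -
  have b: "b \<ge> 2"
    using assms by auto
  have "node k r mod b ^ i mod b ^ (4 * k) = r mod b ^ (4 * k)"
    using assms node_mod_prefix by (simp add: mod_mod_cancel le_imp_power_dvd)
  then show ?thesis
    unfolding node_prefix_def using b by (subst radical_inverse_in_cell_iff) auto
qed

lemma cell_subset: "cell k r \<subseteq> {0..<1} \<times> {0..<1}"
proof -
  have "{radical_inverse b (r mod b ^ (4 * k))..<
      radical_inverse b (r mod b ^ (4 * k)) + 1 / real b ^ (4 * k)} \<subseteq> {0..<1}" if "b \<ge> 2" for b
    using radical_inverse_le [OF that, of "r mod b ^ (4 * k)" "4 * k"] that
      radical_inverse_nonneg [of b "r mod b ^ (4 * k)"] by auto
  from this [of 2] this [of 3] show ?thesis
    unfolding cell_def by (intro Sigma_mono) simp_all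
qed

text \<open>As both intervals contain \<open>x\<close>, the larger of their left endpoints lies in
  both, and \<open>radical_inverse_in_cell_iff\<close> identifies the labels.\<close>

lemma radical_inverse_cell_unique:
  assumes "b \<ge> 2" "a < b ^ i" "a' < b ^ i"
    and "x \<in> {radical_inverse b a..<radical_inverse b a + 1 / real b ^ i}"
    and "x \<in> {radical_inverse b a'..<radical_inverse b a' + 1 / real b ^ i}"
  shows "a = a'"
proof (cases "radical_inverse b a \<le> radical_inverse b a'")
  case True
  then show ?thesis
    using assms radical_inverse_in_cell_iff [OF assms(1,2), of a'] by auto
next
  case False
  then show ?thesis
    using assms radical_inverse_in_cell_iff [OF assms(1,3), of a] by auto
qed

lemma disjoint_cells: "disjoint_family_on (cell k) {..<6 ^ (4 * k)}"
  unfolding disjoint_family_on_def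
proof (intro ballI impI, rule ccontr)
  fix r r' assume r: "r \<in> {..<6 ^ (4 * k)}" "r' \<in> {..<6 ^ (4 * k)}" and "r \<noteq> r'"
    and "cell k r \<inter> cell k r' \<noteq> {}"
  then obtain x y where xy: "(x, y) \<in> cell k r" "(x, y) \<in> cell k r'"
    by auto
  have "r mod 2 ^ (4 * k) = r' mod 2 ^ (4 * k)"
    using xy by (intro radical_inverse_cell_unique [of 2 _ "4 * k" _ x]) (auto simp: cell_def)
  moreover have "r mod 3 ^ (4 * k) = r' mod 3 ^ (4 * k)"
    using xy by (intro radical_inverse_cell_unique [of 3 _ "4 * k" _ y]) (auto simp: cell_def)
  moreover have "coprime (2 ^ (4 * k)) (3 ^ (4 * k) :: nat)"
    by (intro coprime_power_left_iff [THEN iffD2] disjI1 coprime_power_right_iff [THEN iffD2]) simp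
  ultimately have "r mod (2 ^ (4 * k) * 3 ^ (4 * k)) = r' mod (2 ^ (4 * k) * 3 ^ (4 * k))"
    by (simp add: mod_mult_eq_iff_coprime_nat)
  then have "r mod 6 ^ (4 * k) = r' mod 6 ^ (4 * k)"
    by (simp flip: power_mult_distrib)
  with r \<open>r \<noteq> r'\<close> show False
    by simp
qed

section \<open>Lebesgue measure of the cells\<close>

lemma emeasure_lborel_Times_atLeastLessThan:
  fixes a b c d :: real
  assumes "a \<le> b" "c \<le> d"
  shows "emeasure lborel ({a..<b} \<times> {c..<d}) = ennreal ((b - a) * (d - c))"
proof -
  have "emeasure (lborel \<Otimes>\<^sub>M lborel) ({a..<b} \<times> {c..<d})
      = emeasure lborel {a..<b} * emeasure lborel {c..<d}"
    by (intro lborel.emeasure_pair_measure_Times) auto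
  then show ?thesis
    using assms by (simp add: lborel_prod ennreal_mult)
qed

lemma measure_cell:
  shows "cell k r \<in> sets lebesgue" "emeasure lebesgue (cell k r) \<noteq> \<infinity>"
    and "measure lebesgue (cell k r) = 1 / 6 ^ (4 * k)"
proof -
  have cell: "cell k r \<in> sets lborel"
    unfolding cell_def by (auto simp flip: lborel_prod intro!: pair_measureI)
  then show "cell k r \<in> sets lebesgue"
    by simp
  have "emeasure lborel (cell k r) = ennreal (1 / 2 ^ (4 * k) * (1 / 3 ^ (4 * k)))"
    unfolding cell_def by (subst emeasure_lborel_Times_atLeastLessThan) simp_all
  also have "1 / 2 ^ (4 * k) * (1 / 3 ^ (4 * k)) = (1 / 6 ^ (4 * k) :: real)"
    by (simp flip: power_mult_distrib)
  finally have "emeasure lebesgue (cell k r) = ennreal (1 / 6 ^ (4 * k))"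
    using cell by simp
  then show "emeasure lebesgue (cell k r) \<noteq> \<infinity>" "measure lebesgue (cell k r) = 1 / 6 ^ (4 * k)"
    by (simp_all add: measure_def)
qed

lemma measure_Union_cells:
  assumes "G \<subseteq> {..<6 ^ (4 * k)}"
  shows "(\<Union>r\<in>G. cell k r) \<in> sets lebesgue"
    and "measure lebesgue (\<Union>r\<in>G. cell k r) = real (card G) / 6 ^ (4 * k)"
proof -
  have fin: "finite G"
    using assms finite_subset by blast
  then show "(\<Union>r\<in>G. cell k r) \<in> sets lebesgue"
    using measure_cell(1) by (intro sets.finite_UN) auto
  have "measure lebesgue (\<Union>r\<in>G. cell k r) = (\<Sum>r\<in>G. measure lebesgue (cell k r))"
    using fin measure_cell disjoint_family_on_mono [OF assms disjoint_cells]
    by (intro measure_finite_Union) auto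
  then show "measure lebesgue (\<Union>r\<in>G. cell k r) = real (card G) / 6 ^ (4 * k)"
    by (simp add: measure_cell)
qed

section \<open>From rectangles to boxes anchored at the origin\<close>

lemma rectangle_discrepancy:
  assumes "0 \<le> a" "a \<le> b" "0 \<le> c" "c \<le> d"
  shows "(\<Sum>n=1..N. indicator {a..<b} (radical_inverse 2 n) * indicator {c..<d} (radical_inverse 3 n)
            - (b - a) * (d - c))
       = local_discrepancy (b, d) N - local_discrepancy (a, d) N
         - local_discrepancy (b, c) N + local_discrepancy (a, c) N"
proof -
  \<comment> \<open>Inclusion-exclusion, carried out for the indicator and the area alike.\<close>
  have "indicator {a..<b} x * indicator {c..<d} y - (b - a) * (d - c)
      = (indicator ({0..<b} \<times> {0..<d}) (x, y) - b * d)
        - (indicator ({0..<a} \<times> {0..<d}) (x, y) - a * d)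
        - (indicator ({0..<b} \<times> {0..<c}) (x, y) - b * c)
        + (indicator ({0..<a} \<times> {0..<c}) (x, y) - a * c)" for x y :: real
  proof -
    have "indicator {a..<b} x = (indicator {0..<b} x - indicator {0..<a} x :: real)"
      "indicator {c..<d} y = (indicator {0..<d} y - indicator {0..<c} y :: real)"
      using assms by (auto simp: indicator_def)
    moreover have "indicator (A \<times> B) (x, y) = (indicator A x * indicator B y :: real)" for A B
      by (auto simp: indicator_def)
    ultimately show ?thesis
      by (simp only:) (simp add: algebra_simps)
  qed
  then show ?thesis
    unfolding local_discrepancy_def halton23_def
    by (simp only: sum_subtractf [symmetric] sum.distrib [symmetric] fst_conv snd_conv)
qed

text \<open>This trivial bound turns a large discrepancy into a lower bound for
  \<open>N\<close>.\<close>

lemma abs_local_discrepancy_le: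
  assumes "y \<in> {0..<1} \<times> {0..<1}"
  shows "\<bar>local_discrepancy y N\<bar> \<le> real N"
proof -
  have "0 \<le> fst y * snd y" "fst y * snd y \<le> 1"
    using assms by (auto intro: mult_le_one)
  then have "\<bar>indicator A x - fst y * snd y\<bar> \<le> 1" for A and x :: "real \<times> real"
    by (auto simp: indicator_def)
  then have "\<bar>local_discrepancy y N\<bar> \<le> (\<Sum>n=1..N. 1)"
    unfolding local_discrepancy_def by (intro order_trans [OF sum_abs sum_mono])
  then show ?thesis
    by simp
qed

text \<open>The discrepancy of the rectangle is a signed sum of four corner values, so one of them
  carries at least a quarter.\<close>

lemma exists_large_corner:
  assumes "k \<ge> 5" "r < 6 ^ (4 * k)" and D: "box_discrepancy k r N \<ge> (real k)\<^sup>2 / 5"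
  shows "\<exists>y\<in>cell k r. \<bar>local_discrepancy y N\<bar> \<ge> (real k)\<^sup>2 / 20"
proof (rule ccontr)
  assume "\<not> ?thesis"
  then have small: "\<bar>local_discrepancy y N\<bar> < (real k)\<^sup>2 / 20" if "y \<in> cell k r" for y
    using that by force
  have mem: "(node_prefix 2 k r i, node_prefix 3 k r j) \<in> cell k r" if "4 * k \<le> i" "4 * k \<le> j" for i j
    using node_prefix_mem [of 2 k i r] node_prefix_mem [of 3 k j r] that by (simp add: cell_def)
  have nonneg: "0 \<le> node_prefix b k r i" for b i
    by (simp add: node_prefix_def radical_inverse_nonneg)
  let ?\<Delta> = "\<lambda>i j. local_discrepancy (node_prefix 2 k r i, node_prefix 3 k r j) N"
  have "box_discrepancy k r N = ?\<Delta> (16 * k) (16 * k) - ?\<Delta> (12 * k) (16 * k)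
      - ?\<Delta> (16 * k) (12 * k) + ?\<Delta> (12 * k) (12 * k)"
    unfolding box_discrepancy_def using nonneg node_prefix_digits(5,6) [OF assms(1,2)]
    by (intro rectangle_discrepancy)
  moreover have "\<bar>?\<Delta> i j\<bar> < (real k)\<^sup>2 / 20" if "4 * k \<le> i" "4 * k \<le> j" for i j
    using small mem that by blast
  from this [of "16 * k" "16 * k"] this [of "12 * k" "16 * k"] this [of "16 * k" "12 * k"]
    this [of "12 * k" "12 * k"]
  have "\<bar>?\<Delta> (16 * k) (16 * k)\<bar> < (real k)\<^sup>2 / 20" "\<bar>?\<Delta> (12 * k) (16 * k)\<bar> < (real k)\<^sup>2 / 20"
    "\<bar>?\<Delta> (16 * k) (12 * k)\<bar> < (real k)\<^sup>2 / 20" "\<bar>?\<Delta> (12 * k) (12 * k)\<bar> < (real k)\<^sup>2 / 20"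
    by simp_all
  ultimately show False
    using D by linarith
qed

text \<open>Double counting: if every \<open>b\<close> had too few \<open>a\<close> with
  \<open>\<gamma> \<le> D a b\<close>, each sum over \<open>A\<close> would stay below
  \<open>card A * \<alpha>\<close>, against the averages over \<open>B\<close>.\<close>

lemma exists_many_large:
  fixes D :: "'a \<Rightarrow> 'b \<Rightarrow> real"
  assumes "finite A" "finite B" "B \<noteq> {}" "0 \<le> \<gamma>" "0 \<le> \<beta>"
    and D: "\<And>a b. a \<in> A \<Longrightarrow> D a b \<le> \<beta>"
    and sum: "\<And>a. a \<in> A \<Longrightarrow> real (card B) * \<alpha> \<le> (\<Sum>b\<in>B. D a b)"
  shows "\<exists>b\<in>B. real (card A) * (\<alpha> - \<gamma>) \<le> \<beta> * real (card {a \<in> A. \<gamma> \<le> D a b})"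
proof (rule ccontr)
  assume neg: "\<not> ?thesis"
  have "(\<Sum>a\<in>A. D a b) < real (card A) * \<alpha>" if "b \<in> B" for b
  proof -
    \<comment> \<open>Entries below \<open>\<gamma>\<close> cost at most \<open>\<gamma>\<close>,
      the others at most \<open>\<beta>\<close>.\<close>
    have "(\<Sum>a\<in>A. D a b) \<le> (\<Sum>a\<in>A. \<gamma> + \<beta> * of_bool (\<gamma> \<le> D a b))"
      using D assms(4,5) by (intro sum_mono) (auto intro: add_increasing)
    also have "\<dots> = real (card A) * \<gamma> + \<beta> * real (card {a \<in> A. \<gamma> \<le> D a b})"
      using assms(1) by (simp add: sum.distrib sum_of_bool_eq Int_def flip: sum_distrib_left)
    also have "\<dots> < real (card A) * \<alpha>"
      using neg that by (auto simp: algebra_simps not_le)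
    finally show ?thesis .
  qed
  then have "(\<Sum>b\<in>B. \<Sum>a\<in>A. D a b) < (\<Sum>b\<in>B. real (card A) * \<alpha>)"
    using assms(2,3) by (intro sum_strict_mono) auto
  moreover have "(\<Sum>a\<in>A. real (card B) * \<alpha>) \<le> (\<Sum>a\<in>A. \<Sum>b\<in>B. D a b)"
    using sum by (intro sum_mono)
  ultimately show False
    by (subst (asm) sum.swap) (simp add: mult_ac)
qed

lemma exists_N_many_cells:
  assumes "k \<ge> 5"
  obtains N G where "1 \<le> N" "N \<le> 6 ^ (16 * k)" "G \<subseteq> {..<6 ^ (4 * k)}"
    "6 ^ (4 * k) / 16 \<le> real (card G)" "\<And>r. r \<in> G \<Longrightarrow> (real k)\<^sup>2 / 5 \<le> box_discrepancy k r N"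
proof -
  \<comment> \<open>In units of \<open>k ^ 2\<close> the mean is \<open>7 / 10\<close>, the
    threshold \<open>1 / 5\<close> and the cap 8; the proportion is
    \<open>(7 / 10 - 1 / 5) / 8 = 1 / 16\<close>.\<close>
  have "\<exists>N\<in>{1..6 ^ (16 * k)}. real (card {..<6 ^ (4 * k) :: nat}) * (7 / 10 * (real k)\<^sup>2 - (real k)\<^sup>2 / 5)
    \<le> 8 * (real k)\<^sup>2 * real (card {r \<in> {..<6 ^ (4 * k)}. (real k)\<^sup>2 / 5 \<le> box_discrepancy k r N})"
    using box_discrepancy_bounds [OF assms] by (intro exists_many_large) auto
  then obtain N where N: "1 \<le> N" "N \<le> 6 ^ (16 * k)"
    "6 ^ (4 * k) * (7 / 10 * (real k)\<^sup>2 - (real k)\<^sup>2 / 5)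
    \<le> 8 * (real k)\<^sup>2 * real (card {r \<in> {..<6 ^ (4 * k)}. (real k)\<^sup>2 / 5 \<le> box_discrepancy k r N})"
    by auto
  let ?G = "{r \<in> {..<6 ^ (4 * k)}. (real k)\<^sup>2 / 5 \<le> box_discrepancy k r N}"
  have "8 * (real k)\<^sup>2 * (6 ^ (4 * k) / 16) \<le> 8 * (real k)\<^sup>2 * real (card ?G)"
    using N(3) by (simp add: algebra_simps)
  moreover have "8 * (real k)\<^sup>2 > 0"
    using assms by simp
  ultimately have "6 ^ (4 * k) / 16 \<le> real (card ?G)"
    by (simp only: mult_le_cancel_left_pos)
  with N(1,2) show thesis
    by (intro that [of N ?G]) auto
qed

lemma cell_diameter:
  assumes "x \<in> cell k r" "y \<in> cell k r" "1 \<le> N" "N \<le> 6 ^ (16 * k)"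
  shows "norm (x - y) < sqrt 8 * real N powr (-1/14)"
proof -
  have fst: "\<bar>fst x - fst y\<bar> < 1 / 2 ^ (4 * k)"
    using assms(1,2) by (auto simp: cell_def)
  have "\<bar>snd x - snd y\<bar> < 1 / 3 ^ (4 * k)"
    using assms(1,2) by (auto simp: cell_def)
  also have "\<dots> \<le> 1 / (2 :: real) ^ (4 * k)"
    by (intro divide_left_mono power_mono) auto
  finally have snd: "\<bar>snd x - snd y\<bar> < 1 / 2 ^ (4 * k)" .
  have "norm (x - y) \<le> \<bar>fst x - fst y\<bar> + \<bar>snd x - snd y\<bar>"
    using norm_Pair_le [of "fst x - fst y" "snd x - snd y"] by (simp add: minus_prod_def)
  also have "\<dots> < 2 * (1 / 2 ^ (4 * k))"
    using fst snd by simp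
  also have "\<dots> \<le> sqrt 8 * real N powr (-1/14)"
  proof (intro mult_mono)
    show "2 \<le> sqrt 8"
      by (rule real_le_rsqrt) simp
    \<comment> \<open>The exponent is \<open>56 = 14 * 4\<close>, so the power
      \<open>-1 / 14\<close> yields exactly the side length \<open>1 / 2 ^ (4 * k)\<close>.\<close>
    have "(6 :: nat) ^ (16 * k) \<le> 2 ^ (56 * k)"
      unfolding power_mult by (rule power_mono) simp_all
    with assms(4) have "real N \<le> real (2 ^ (56 * k))"
      by (meson of_nat_le_iff order_trans)
    moreover have "real (2 ^ (56 * k)) = 2 powr real (56 * k)"
      by (subst powr_realpow) simp_all
    ultimately have N: "real N \<le> 2 powr real (56 * k)"
      by (simp only:)
    have "1 / 2 ^ (4 * k) = (2 :: real) powr (- real (4 * k))"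
      by (simp only: powr_minus_divide powr_realpow zero_less_numeral)
    also have "\<dots> = (2 powr real (56 * k)) powr (-1/14)"
      by (simp add: powr_powr)
    also have "\<dots> \<le> real N powr (-1/14)"
      using N assms(3) by (intro powr_mono2') auto
    finally show "1 / 2 ^ (4 * k) \<le> real N powr (-1/14)" .
  qed auto
  finally show ?thesis .
qed

theorem theorem5:
  shows "\<exists>c1>0. \<exists>c2>0. \<exists>\<^sub>\<infinity>N::nat. N \<ge> 1 \<and>
     (\<exists>\<Lambda>. \<Lambda> \<subseteq> {0..<1} \<times> {0..<1} \<and> \<Lambda> \<in> sets lebesgue \<and>
        measure lebesgue \<Lambda> \<ge> c1 \<and>
        (\<forall>x\<in>\<Lambda>. \<exists>y \<in> {0..<1} \<times> {0..<1}.
           norm (x - y) < sqrt 8 * real N powr (-1/14) \<and>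
           \<bar>local_discrepancy y N\<bar> \<ge> c2 * (ln (real N))^2))"
proof (intro exI conjI)
  \<comment> \<open>The first constant is the proportion of good cells. The second is
    \<open>1 / (20 * 80 ^ 2)\<close>, from the corner bound \<open>k ^ 2 / 20\<close> and
    \<open>ln N \<le> 16 * k * ln 6 \<le> 80 * k\<close>.\<close>
  show "(1 / 16 :: real) > 0" "(1 / 128000 :: real) > 0"
    by simp_all
  show "\<exists>\<^sub>\<infinity>N::nat. N \<ge> 1 \<and>
     (\<exists>\<Lambda>. \<Lambda> \<subseteq> {0..<1} \<times> {0..<1} \<and> \<Lambda> \<in> sets lebesgue \<and>
        measure lebesgue \<Lambda> \<ge> 1 / 16 \<and>
        (\<forall>x\<in>\<Lambda>. \<exists>y \<in> {0..<1} \<times> {0..<1}.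
           norm (x - y) < sqrt 8 * real N powr (-1/14) \<and>
           \<bar>local_discrepancy y N\<bar> \<ge> 1 / 128000 * (ln (real N))^2))"
    unfolding INFM_nat
  proof (intro allI)
    fix m :: nat
    \<comment> \<open>Then \<open>k ^ 2 / 20 = 20 * (m + 1) ^ 2\<close> exceeds \<open>m\<close>,
      and the trivial discrepancy bound pushes \<open>N\<close> beyond \<open>m\<close>.\<close>
    define k where "k = 20 * (m + 1)"
    have k: "k \<ge> 5"
      by (simp add: k_def)
    obtain N G where N: "1 \<le> N" "N \<le> 6 ^ (16 * k)" and G: "G \<subseteq> {..<6 ^ (4 * k)}"
      "6 ^ (4 * k) / 16 \<le> real (card G)"
      "\<And>r. r \<in> G \<Longrightarrow> (real k)\<^sup>2 / 5 \<le> box_discrepancy k r N"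
      using exists_N_many_cells [OF k] by blast
    have corner: "\<exists>y\<in>cell k r. \<bar>local_discrepancy y N\<bar> \<ge> (real k)\<^sup>2 / 20" if "r \<in> G" for r
      using exists_large_corner [OF k] G that by blast
    have "N > m"
    proof -
      have "0 < (6 :: real) ^ (4 * k) / 16"
        by simp
      with G(2) have "card G > 0"
        by linarith
      then obtain r where "r \<in> G"
        by (metis card_gt_0_iff equals0I)
      then obtain y where y: "y \<in> cell k r" "\<bar>local_discrepancy y N\<bar> \<ge> (real k)\<^sup>2 / 20"
        using corner by blast
      have "(real k)\<^sup>2 / 20 \<le> real N"
        using y(2) abs_local_discrepancy_le [of y N] cell_subset [of k r] y(1) by force
      moreover have "real m < (real k)\<^sup>2 / 20"
        by (simp add: k_def power2_eq_square algebra_simps add_pos_nonneg)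
      ultimately show ?thesis
        by linarith
    qed
    have ln: "1 / 128000 * (ln (real N))\<^sup>2 \<le> (real k)\<^sup>2 / 20"
    proof -
      have "ln (real N) \<le> ln (6 ^ (16 * k))"
      proof -
        have "real N \<le> 6 ^ (16 * k)"
          using N(2) by (metis of_nat_le_iff of_nat_numeral of_nat_power)
        then show ?thesis
          by (rule ln_mono) (use N(1) in simp)
      qed
      also have "\<dots> = real (16 * k) * ln 6"
        by (rule ln_realpow)
      also have "\<dots> \<le> real (16 * k) * 5"
        using ln_le_minus_one [of 6] by (intro mult_left_mono) auto
      finally have "ln (real N) \<le> 80 * real k"
        by simp
      moreover have "0 \<le> ln (real N)"
        using N by simp
      ultimately have "(ln (real N))\<^sup>2 \<le> (80 * real k)\<^sup>2"
        by (intro power_mono)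
      then show ?thesis
        by (simp add: power_mult_distrib)
    qed
    have "\<exists>y\<in>{0..<1} \<times> {0..<1}. norm (x - y) < sqrt 8 * real N powr (-1/14) \<and>
        \<bar>local_discrepancy y N\<bar> \<ge> 1 / 128000 * (ln (real N))^2"
      if x: "x \<in> (\<Union>r\<in>G. cell k r)" for x
    proof -
      obtain r where r: "r \<in> G" "x \<in> cell k r"
        using x by blast
      then obtain y where y: "y \<in> cell k r" "\<bar>local_discrepancy y N\<bar> \<ge> (real k)\<^sup>2 / 20"
        using corner by blast
      show ?thesis
        using cell_subset y ln cell_diameter [OF r(2) y(1) N] by (intro bexI [of _ y]) auto
    qed
    moreover have "(\<Union>r\<in>G. cell k r) \<subseteq> {0..<1} \<times> {0..<1}"
      using cell_subset by blast
    moreover have "measure lebesgue (\<Union>r\<in>G. cell k r) \<ge> 1 / 16"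
      using G(2) by (simp add: measure_Union_cells(2) [OF G(1)] field_simps)
    ultimately show "\<exists>N>m. N \<ge> 1 \<and>
     (\<exists>\<Lambda>. \<Lambda> \<subseteq> {0..<1} \<times> {0..<1} \<and> \<Lambda> \<in> sets lebesgue \<and>
        measure lebesgue \<Lambda> \<ge> 1 / 16 \<and>
        (\<forall>x\<in>\<Lambda>. \<exists>y \<in> {0..<1} \<times> {0..<1}.
           norm (x - y) < sqrt 8 * real N powr (-1/14) \<and>
           \<bar>local_discrepancy y N\<bar> \<ge> 1 / 128000 * (ln (real N))^2))"
      using \<open>N > m\<close> N(1) measure_Union_cells(1) [OF G(1)] by blast
  qed
qed

end
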